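(* For positive integers $m,k$, let $N(m,k)$ denote the minimal $n\in\{1,2,\ldots\}$ such that for every polygon $P\subseteq\mathbb{R}^2$ with exactly $m$ edges there exist real polynomials $p_1,\ldots,p_n$ in two variables, each of degree at most $k$, with $$\operatorname{int}P=\{x\in\mathbb{R}^2: p_1(x)>0,\ldots,p_n(x)>0\}.$$ Let $\overline{N}(m,k)$ denote the minimal $n\in\{1,2,\ldots\}$ such that for every polygon $P\subseteq\mathbb{R}^2$ with exactly $m$ edges there exist real polynomials $p_1,\ldots,p_n$ in two variables, each of degree at most $k$, with $$P=\{x\in\mathbb{R}^2: p_1(x)\ge 0,\ldots,p_n(x)\ge 0\}.$$ Then there exists a sequence of real numbers $(\varepsilon_m)_{m\ge 2}$ with $\varepsilon_m\to 0$ as $m\to\infty$ such that for all integers $m\ge 2$ and $k\ge 1$ with $k\le m/\log_2 m$ one has $$\frac{m}{k}\le N(m,k)\le (1+\varepsilon_m)\,\frac{m}{k}.$$ The same statement holds with $\overline{N}(m,k)$ in place of $N(m,k)$.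
   Context: A polygon is a subset $P\subseteq\mathbb{R}^2$ that is the intersection of finitely many closed half-planes and has non-empty interior; it may be unbounded. Edges of $P$ are its one-dimensional faces (segments, rays or lines). $\operatorname{int}P$ is the topological interior of $P$. *)

theory Defs
  imports
    "HOL-Analysis.Analysis"
    "HOL-Computational_Algebra.Polynomial"
begin

definition polygon :: "(real^2) set \<Rightarrow> bool" where
  "polygon P \<longleftrightarrow> polyhedron P \<and> interior P \<noteq> {}"

definition edges :: "(real^2) set \<Rightarrow> (real^2) set set" where
  "edges P = {e. e edge_of P}"

text \<open>
  A polynomial in two variables is an element of \<open>real poly poly\<close>: the monomial
  \<open>X\<^sup>j Y\<^sup>i\<close> has coefficient \<open>coeff (coeff p i) j\<close>, so the outer variable is \<open>Y\<close>,
  evaluated at the second coordinate. The zero polynomial gets total degree 0.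
\<close>

definition eval2 :: "real poly poly \<Rightarrow> real^2 \<Rightarrow> real" where
  "eval2 p x = poly (poly p [:x $ 2:]) (x $ 1)"

definition total_degree :: "real poly poly \<Rightarrow> nat" where
  "total_degree p = Max (insert 0 {i + j |i j. coeff (coeff p i) j \<noteq> 0})"

lemma finite_monomials: "finite {i + j |i j. coeff (coeff p i) j \<noteq> 0}"
  for p :: "real poly poly"
proof -
  have "{i + j |i j. coeff (coeff p i) j \<noteq> 0}
      \<subseteq> (\<lambda>(i, j). i + j) ` (SIGMA i : {..degree p}. {..degree (coeff p i)})"
    by (force simp: image_iff intro: le_degree)
  then show ?thesis
    by (rule finite_subset) auto
qed

lemma total_degree_le_iff:
  "total_degree p \<le> k \<longleftrightarrow> (\<forall>i j. coeff (coeff p i) j \<noteq> 0 \<longrightarrow> i + j \<le> k)"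
  unfolding total_degree_def using finite_monomials[of p] by auto

lemma eval2_altdef:
  "eval2 p x = (\<Sum>i\<le>degree p. \<Sum>j\<le>degree (coeff p i).
     coeff (coeff p i) j * (x $ 1) ^ j * (x $ 2) ^ i)"
proof -
  have "[:c:] ^ i = [:c ^ i:]" for c :: real and i
    by (induction i) auto
  then show ?thesis
    unfolding eval2_def poly_altdef[of p] poly_sum
    by (simp add: poly_altdef[of "coeff p _"] sum_distrib_left mult_ac)
qed

definition open_representable :: "nat \<Rightarrow> nat \<Rightarrow> (real^2) set \<Rightarrow> bool" where
  "open_representable n k P \<longleftrightarrow>
     (\<exists>p :: nat \<Rightarrow> real poly poly.
        (\<forall>i\<in>{1..n}. total_degree (p i) \<le> k) \<and>
        interior P = {x. \<forall>i\<in>{1..n}. eval2 (p i) x > 0})"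

definition closed_representable :: "nat \<Rightarrow> nat \<Rightarrow> (real^2) set \<Rightarrow> bool" where
  "closed_representable n k P \<longleftrightarrow>
     (\<exists>p :: nat \<Rightarrow> real poly poly.
        (\<forall>i\<in>{1..n}. total_degree (p i) \<le> k) \<and>
        P = {x. \<forall>i\<in>{1..n}. eval2 (p i) x \<ge> 0})"

text \<open>
  For \<open>m, k \<ge> 1\<close> the minima below are attained, since a polygon with \<open>m\<close> edges is
  cut out by \<open>m\<close> affine inequalities.
\<close>

definition N_open :: "nat \<Rightarrow> nat \<Rightarrow> nat" where
  "N_open m k =
     (LEAST n. n \<ge> 1 \<and> (\<forall>P. polygon P \<and> card (edges P) = m \<longrightarrow> open_representable n k P))"

definition N_closed :: "nat \<Rightarrow> nat \<Rightarrow> nat" where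
  "N_closed m k =
     (LEAST n. n \<ge> 1 \<and> (\<forall>P. polygon P \<and> card (edges P) = m \<longrightarrow> closed_representable n k P))"

end

theory Submission
  imports
    Defs
    "HOL-Number_Theory.Cong"
    "HOL-Real_Asymp.Real_Asymp"
begin

text \<open>
  Lower bound: the line of every edge lies in the zero set of one of the polynomials, and a nonzero
  polynomial of degree at most \<open>k\<close> vanishes on at most \<open>k\<close> lines.

  Upper bound: order the edges cyclically. A point outside of the polygon violates the affine
  constraints of consecutive edges; one extra polynomial, the constraint of the edge \<open>0\<close> itself,
  reduces this to intervals of edges \<open>1, \<dots>, m - 1\<close>. Colour these edges and multiply the
  constraints of each colour. The products cut out the polygon if every interval of edges contains a
  colour exactly once, even after adding the two neighbours of the interval, on whose lines the point
  may lie. Ruler sequences (2-adic valuations) have this property and are spread by cyclic shifts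
  over \<open>a > m / k\<close> colours such that each is used at most \<open>k\<close> times; \<open>log a\<close> further
  colours separate the shifted copies. Since \<open>m / k \<ge> log m\<close>, the \<open>log a\<close> further colours
  are negligible.
\<close>

section \<open>Bivariate polynomials\<close>

lemma eval2_simps [simp]:
  "eval2 1 x = 1" "eval2 (p * q) x = eval2 p x * eval2 q x"
  by (simp_all add: eval2_def)

lemma eval2_prod: "eval2 (\<Prod>i\<in>S. p i) x = (\<Prod>i\<in>S. eval2 (p i) x)"
  by (induction S rule: infinite_finite_induct) auto

lemma continuous_on_eval2: "continuous_on S (eval2 p)"
  unfolding eval2_altdef by (intro continuous_intros)

lemma total_degree_one: "total_degree 1 = 0"
  using total_degree_le_iff[of 1 0] by (auto simp: one_pCons coeff_pCons split: nat.splits)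

lemma total_degree_mult_le: "total_degree (p * q) \<le> total_degree p + total_degree q"
  unfolding total_degree_le_iff
proof (intro allI impI)
  fix i j
  assume "coeff (coeff (p * q) i) j \<noteq> 0"
  then have "(\<Sum>r\<le>i. \<Sum>s\<le>j. coeff (coeff p r) s * coeff (coeff q (i - r)) (j - s)) \<noteq> 0"
    by (simp add: coeff_mult coeff_sum)
  then obtain r where "r \<le> i" "(\<Sum>s\<le>j. coeff (coeff p r) s * coeff (coeff q (i - r)) (j - s)) \<noteq> 0"
    by (meson atMost_iff sum.not_neutral_contains_not_neutral)
  moreover then obtain s where "s \<le> j" "coeff (coeff p r) s * coeff (coeff q (i - r)) (j - s) \<noteq> 0"
    by (meson atMost_iff sum.not_neutral_contains_not_neutral)
  moreover have "r + s \<le> total_degree p" "i - r + (j - s) \<le> total_degree q"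
    using calculation total_degree_le_iff[of p "total_degree p"]
      total_degree_le_iff[of q "total_degree q"] mult_not_zero by blast+
  ultimately show "i + j \<le> total_degree p + total_degree q"
    by linarith
qed

lemma total_degree_prod_le:
  "total_degree (\<Prod>i\<in>S. p i) \<le> (\<Sum>i\<in>S. total_degree (p i))"
proof (induction S rule: infinite_finite_induct)
  case (insert x F)
  then show ?case
    using total_degree_mult_le[of "p x" "prod p F"] by simp
qed (use total_degree_one in auto)

definition affine_form :: "real^2 \<Rightarrow> real \<Rightarrow> real poly poly" where
  "affine_form u c = [:[:c, - u $ 1:], [:- u $ 2:]:]"

lemma eval2_affine_form: "eval2 (affine_form u c) x = c - u \<bullet> x"
  by (simp add: eval2_def affine_form_def inner_vec_def UNIV_2 algebra_simps)

lemma total_degree_affine_form: "total_degree (affine_form u c) \<le> 1"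
  by (auto simp: total_degree_le_iff affine_form_def coeff_pCons split: nat.splits)

lemma degree_le_total_degree: "degree p \<le> total_degree p"
proof (cases "p = 0")
  case False
  then have "coeff (coeff p (degree p)) (degree (coeff p (degree p))) \<noteq> 0"
    by (metis leading_coeff_0_iff)
  then show ?thesis
    using total_degree_le_iff[of p "total_degree p"] add_leD1 by blast
qed auto

section \<open>Balanced conflict-free colourings of intervals\<close>

text \<open>Between two numbers of equal valuation there is one of larger valuation.\<close>

lemma valuation_unique_in_interval:
  fixes s t :: nat
  assumes "s < t"
  obtains x where "s < x" "x \<le> t"
    "\<And>y. s \<le> y \<Longrightarrow> y \<le> Suc t \<Longrightarrow> 0 < y \<Longrightarrow> multiplicity 2 y = multiplicity 2 x \<Longrightarrow> y = x"
proof -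
  let ?v = "multiplicity (2::nat)"
  obtain x where x: "x \<in> {s<..t}" and mx: "\<And>z. z \<in> {s<..t} \<Longrightarrow> ?v z \<le> ?v x"
    using assms obtains_MAX[of "{s<..t}" ?v]
    by (metis Max_ge finite_greaterThanAtMost finite_imageI greaterThanAtMost_empty_iff imageI less_le_not_le)
  \<comment> \<open>An even multiple of \<open>2 ^ ?v x\<close> lies strictly between
    \<open>u\<close> and \<open>w\<close>, hence in \<open>{s<..t}\<close> even if
    \<open>u = s\<close> or \<open>w = Suc t\<close>. The condition \<open>0 < u\<close> excludes
    the default value \<open>multiplicity 2 0 = 0\<close>.\<close>
  have gap: False
    if uw: "u < w" "0 < u" "s \<le> u" "w \<le> Suc t" and eq: "?v u = ?v x" "?v w = ?v x" for u w
  proof -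
    obtain u' where u': "u = 2 ^ ?v x * u'" "odd u'"
      using multiplicity_decompose'[of u 2] uw(2) eq(1) by auto
    obtain w' where w': "w = 2 ^ ?v x * w'" "odd w'"
      using multiplicity_decompose'[of w 2] uw(1) eq(2) by auto
    have "u' < w'"
      using \<open>u < w\<close> u' w' by simp
    moreover have "Suc u' \<noteq> w'"
      using u'(2) w'(2) by auto
    ultimately have "Suc u' < w'"
      by simp
    then have "2 ^ ?v x * Suc u' < w"
      by (subst w'(1)) (simp del: mult_Suc_right)
    moreover have "u < 2 ^ ?v x * Suc u'"
      using u' by simp
    ultimately have "?v (2 ^ ?v x * Suc u') \<le> ?v x"
      using uw(3,4) by (intro mx) auto
    moreover have "2 ^ Suc (?v x) dvd 2 ^ ?v x * Suc u'"
      using u'(2) by (simp del: mult_Suc_right)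
    then have "Suc (?v x) \<le> ?v (2 ^ ?v x * Suc u')"
      by (intro multiplicity_geI) auto
    ultimately show False
      by simp
  qed
  show thesis
  proof (rule that)
    fix y
    assume y: "s \<le> y" "y \<le> Suc t" "0 < y" "?v y = ?v x"
    have x': "s < x" "x \<le> Suc t" "s \<le> x" "0 < x"
      using x by auto
    have "\<not> x < y" "\<not> y < x"
      using gap[of x y, OF _ x'(4,3) y(2) refl y(4)] gap[of y x, OF _ y(3,1) x'(2) y(4) refl] by blast+
    then show "y = x"
      by simp
  qed (use x in auto)
qed

text \<open>
  Positions are grouped in blocks of length \<open>L + 1\<close>. The last position of a block separates it
  from the next one, and the separators carry their own ruler colours; thus a unique colour exists
  for every interval meeting a separator, and the colouring \<open>w\<close> inside the blocks has to serve only
  the intervals without separators.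
\<close>

locale block_colouring =
  fixes L a :: nat and w :: "nat \<Rightarrow> nat \<Rightarrow> nat"
  assumes w_less: "r < L \<Longrightarrow> w i r < a"
    and w_unique: "s < t \<Longrightarrow> t \<le> L \<Longrightarrow>
      \<exists>x. s \<le> x \<and> x < t \<and> (\<forall>y<L. s \<le> Suc y \<longrightarrow> y \<le> t \<longrightarrow> w i y = w i x \<longrightarrow> y = x)"
begin

text \<open>Separator colours start at \<open>a\<close>, so they never meet those of
  \<open>w\<close>. Blocks count from 1 in the valuation, which keeps its argument positive.\<close>

definition colour :: "nat \<Rightarrow> nat" where
  "colour t = (if t mod Suc L < L then w (t div Suc L) (t mod Suc L)
     else a + multiplicity 2 (Suc (t div Suc L)))"

lemma colour_ge_iff: "a \<le> colour t \<longleftrightarrow> t mod Suc L = L"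
proof -
  have "t mod Suc L < Suc L"
    by simp
  then show ?thesis
    using w_less[of "t mod Suc L" "t div Suc L"]
    by (auto simp: colour_def not_le[symmetric])
qed

text \<open>The conditions \<open>s \<le> Suc y\<close> and \<open>y \<le> t\<close> add both
  neighbours to the interval \<open>[s, t)\<close> without truncated subtraction. If the interval
  contains a separator, the ruler colours decide, otherwise \<open>w\<close> on a single
  block.\<close>

lemma colour_unique:
  assumes "s < t"
  shows "\<exists>x. s \<le> x \<and> x < t \<and> (\<forall>y. s \<le> Suc y \<longrightarrow> y \<le> t \<longrightarrow> colour y = colour x \<longrightarrow> y = x)"
proof (cases "s div Suc L < t div Suc L")
  case True
  then obtain q where q: "s div Suc L < q" "q \<le> t div Suc L"
    and uniq: "\<And>y. s div Suc L \<le> y \<Longrightarrow> y \<le> Suc (t div Suc L) \<Longrightarrow> 0 < y \<Longrightarrow>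
      multiplicity 2 y = multiplicity 2 q \<Longrightarrow> y = q"
    using valuation_unique_in_interval by metis
  \<comment> \<open>This separator has colour \<open>a + multiplicity 2 q\<close>. The neighbours of
    the interval may add the block boundaries \<open>s div Suc L\<close> and
    \<open>Suc (t div Suc L)\<close>, which \<open>uniq\<close> tolerates.\<close>
  define x where "x = (q - 1) * Suc L + L"
  have x: "Suc x = q * Suc L"
    using q by (cases q) (auto simp: x_def)
  have xm: "x mod Suc L = L" "x div Suc L = q - 1"
    unfolding x_def by (simp_all del: mult_Suc_right)
  have "s \<le> x"
    using q(1) x by (metis Suc_leI div_less_iff_less_mult less_Suc_eq_le zero_less_Suc)
  moreover have "x < t"
    using q(2) x by (metis Suc_le_lessD less_eq_div_iff_mult_less_eq zero_less_Suc)
  moreover have "y = x" if y: "s \<le> Suc y" "y \<le> t" "colour y = colour x" for y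
  proof -
    have cx: "colour x = a + multiplicity 2 q"
      using xm q by (simp add: colour_def)
    have ym: "y mod Suc L = L"
      using colour_ge_iff[of y] y(3) cx by simp
    then have sy: "Suc y = Suc (y div Suc L) * Suc L"
      by (metis add.commute add_Suc_right div_mult_mod_eq mult_Suc)
    have "multiplicity 2 (Suc (y div Suc L)) = multiplicity 2 q"
      using y(3) cx ym by (simp add: colour_def)
    moreover have "s div Suc L \<le> Suc (y div Suc L)"
      using sy y(1) by (metis div_le_mono nonzero_mult_div_cancel_right nat.distinct(1))
    moreover have "y div Suc L \<le> t div Suc L"
      using y(2) by (rule div_le_mono)
    ultimately have "Suc (y div Suc L) = q"
      by (intro uniq) auto
    then show ?thesis
      using sy x by simp
  qed
  ultimately show ?thesis
    by blast
next
  case False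
  define i where "i = s div Suc L"
  have i: "t div Suc L = i"
    using False assms by (metis div_le_mono i_def le_neq_implies_less less_imp_le)
  define s' t' where "s' = s mod Suc L" and "t' = t mod Suc L"
  have s: "s = i * Suc L + s'" and t: "t = i * Suc L + t'"
    using div_mult_mod_eq[of s "Suc L"] div_mult_mod_eq[of t "Suc L"] i
    by (simp_all only: i_def s'_def t'_def)
  have "s' < t'"
    using assms s t by linarith
  moreover have "t' \<le> L"
    unfolding t'_def by (simp add: less_Suc_eq_le[symmetric])
  ultimately obtain x where x: "s' \<le> x" "x < t'"
    and uniq: "\<And>y. y < L \<Longrightarrow> s' \<le> Suc y \<Longrightarrow> y \<le> t' \<Longrightarrow> w i y = w i x \<Longrightarrow> y = x"
    using w_unique by metis
  have cx: "colour (i * Suc L + x) = w i x"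
    using x(2) \<open>t' \<le> L\<close> by (simp add: colour_def del: mult_Suc_right)
  have "y = i * Suc L + x" if y: "s \<le> Suc y" "y \<le> t" "colour y = w i x" for y
  proof -
    have ym: "y mod Suc L < L"
      using w_less[of x i] x \<open>t' \<le> L\<close> y(3) by (auto simp: colour_def split: if_splits)
    \<comment> \<open>As \<open>y\<close> is no separator, its successor is in the same block; so
      \<open>s \<le> Suc y\<close> does not let in the preceding block.\<close>
    then have "Suc y div Suc L = y div Suc L"
      by (simp add: div_Suc mod_Suc)
    then have yi: "y div Suc L = i"
      using div_le_mono[OF y(1), of "Suc L"] div_le_mono[OF y(2), of "Suc L"] i i_def by simp
    then have yy: "y = i * Suc L + y mod Suc L"
      by (metis div_mult_mod_eq)
    have "y mod Suc L = x"
    proof (rule uniq[OF ym])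
      show "s' \<le> Suc (y mod Suc L)" "y mod Suc L \<le> t'"
        using y(1,2) s t yy by linarith+
      show "w i (y mod Suc L) = w i x"
        using y(3) yi ym by (simp add: colour_def)
    qed
    then show ?thesis
      using yy by simp
  qed
  then show ?thesis
    using x s t cx by (intro exI[of _ "i * Suc L + x"]) auto
qed

text \<open>A positive number at most \<open>B < 2 ^ b\<close> has valuation below
  \<open>b\<close>.\<close>

lemma colour_less:
  assumes "t < B * Suc L" "B < 2 ^ b"
  shows "colour t < a + b"
proof (cases "t mod Suc L < L")
  case False
  let ?q = "Suc (t div Suc L)"
  have "2 ^ multiplicity 2 ?q \<le> ?q"
    by (intro dvd_imp_le multiplicity_dvd) simp
  also have "\<dots> \<le> B"
    using less_mult_imp_div_less[OF assms(1)] by simp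
  also have "\<dots> < 2 ^ b"
    by fact
  finally show ?thesis
    using False by (simp add: colour_def)
qed (use w_less in \<open>auto simp: colour_def intro: trans_less_add1\<close>)

text \<open>A colour of \<open>w\<close> is counted by pairs of block and offset; a separator colour
  occurs at most once in each of the \<open>B \<le> k\<close> blocks.\<close>

lemma card_colour_le:
  assumes "m \<le> B * Suc L" "B \<le> k"
    and w_card: "\<And>c. c < a \<Longrightarrow> card {(i, r). i < B \<and> r < L \<and> w i r = c} \<le> k"
  shows "card {t. t < m \<and> colour t = c} \<le> k"
proof (cases "c < a")
  case True
  let ?f = "\<lambda>t. (t div Suc L, t mod Suc L)" and ?A = "{t. t < m \<and> colour t = c}"
  have "inj_on ?f ?A"
    by (rule inj_onI) (metis Pair_inject div_mult_mod_eq)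
  then have "card ?A = card (?f ` ?A)"
    by (simp add: card_image)
  also have "\<dots> \<le> card {(i, r). i < B \<and> r < L \<and> w i r = c}"
  proof (rule card_mono)
    show "finite {(i, r). i < B \<and> r < L \<and> w i r = c}"
      by (rule finite_subset[of _ "{..<B} \<times> {..<L}"]) auto
    show "?f ` ?A \<subseteq> {(i, r). i < B \<and> r < L \<and> w i r = c}"
      using True assms(1) by (auto simp: colour_def split: if_splits intro!: less_mult_imp_div_less)
  qed
  also have "\<dots> \<le> k"
    by (rule w_card[OF True])
  finally show ?thesis .
next
  case False
  let ?A = "{t. t < m \<and> colour t = c}"
  have m: "t mod Suc L = L" if "t \<in> ?A" for t
    using that False colour_ge_iff[of t] by auto
  have "inj_on (\<lambda>t. t div Suc L) ?A"
    by (rule inj_onI) (metis m div_mult_mod_eq)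
  moreover have "t div Suc L < k" if "t \<in> ?A" for t
    using that less_mult_imp_div_less[of t B "Suc L"] assms by simp
  ultimately have "card ?A \<le> card {..<k}"
    by (intro card_inj_on_le) auto
  then show ?thesis
    by simp
qed

end

text \<open>Use \<open>k\<close> blocks of length \<open>a\<close> if \<open>k \<le> a\<close>, and
  \<open>a\<close> blocks of length \<open>k\<close> otherwise. Either way there are at most
  \<open>a < 2 ^ b\<close> blocks, so \<open>b\<close> colours suffice for the separators.\<close>

lemma balanced_conflict_free_colouring:
  fixes m k a b :: nat
  assumes "m \<le> a * k" "k < 2 ^ a" "a < 2 ^ b"
  obtains c :: "nat \<Rightarrow> nat" where
    "\<And>t. t < m \<Longrightarrow> c t < a + b" "\<And>j. card {t. t < m \<and> c t = j} \<le> k"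
    "\<And>s t. s < t \<Longrightarrow> \<exists>x. s \<le> x \<and> x < t \<and> (\<forall>y. s \<le> Suc y \<longrightarrow> y \<le> t \<longrightarrow> c y = c x \<longrightarrow> y = x)"
proof (cases "k \<le> a")
  case True
  \<comment> \<open>Each colour occurs once in each of the \<open>k\<close> blocks.\<close>
  interpret block_colouring a a "\<lambda>i r. r"
    by unfold_locales auto
  have m: "m \<le> k * Suc a"
    using assms(1) by (simp add: mult.commute)
  show thesis
  proof (rule that[of colour])
    show "colour t < a + b" if "t < m" for t
      using that m True assms(3) by (intro colour_less[of t k b]) auto
    show "card {t. t < m \<and> colour t = j} \<le> k" for j
    proof (rule card_colour_le[OF m order.refl])
      fix c
      have "{(i, r). i < k \<and> r < a \<and> r = c} \<subseteq> (\<lambda>i. (i, c)) ` {..<k}"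
        by auto
      then have "card {(i, r). i < k \<and> r < a \<and> r = c} \<le> card {..<k}"
        by (rule surj_card_le[OF finite_lessThan])
      then show "card {(i, r). i < k \<and> r < a \<and> r = c} \<le> k"
        by simp
    qed
  qed (rule colour_unique)
next
  case False
  \<comment> \<open>Block \<open>i\<close> carries the ruler sequence shifted cyclically by
    \<open>i\<close>. Since \<open>k < 2 ^ a\<close>, the valuations of \<open>1\<close> to
    \<open>k\<close> are below \<open>a\<close>, so reduction modulo \<open>a\<close> merges no
    colours within a block.\<close>
  define w where "w i r = (i + multiplicity 2 (Suc r)) mod a" for i r
  have "a > 0"
    using False assms by (cases a) auto
  have v: "multiplicity 2 (Suc r) < a" if "r < k" for r
  proof -
    have "2 ^ multiplicity 2 (Suc r) \<le> Suc r"
      by (intro dvd_imp_le multiplicity_dvd) simp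
    also have "\<dots> < 2 ^ a"
      using that assms(2) by simp
    finally show ?thesis
      by simp
  qed
  have w_inj: "multiplicity 2 (Suc x) = multiplicity 2 (Suc y)"
    if "w i x = w i y" "x < k" "y < k" for i x y
    using that v[of x] v[of y] cong_add_lcancel_nat[of i "multiplicity 2 (Suc x)" "multiplicity 2 (Suc y)" a]
    by (auto simp: w_def cong_def)
  interpret block_colouring k a w
  proof
    fix s t i :: nat
    assume "s < t" "t \<le> k"
    then obtain x where x: "s < x" "x \<le> t"
      "\<And>y. s \<le> y \<Longrightarrow> y \<le> Suc t \<Longrightarrow> 0 < y \<Longrightarrow> multiplicity 2 y = multiplicity 2 x \<Longrightarrow> y = x"
      using valuation_unique_in_interval by metis
    obtain z where z: "x = Suc z"
      using x(1) by (cases x) auto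
    have "y = z" if y: "y < k" "s \<le> Suc y" "y \<le> t" "w i y = w i z" for y
      using x(3)[of "Suc y"] w_inj[OF y(4)] y x(2) \<open>t \<le> k\<close> z by simp
    then show "\<exists>x. s \<le> x \<and> x < t \<and> (\<forall>y<k. s \<le> Suc y \<longrightarrow> y \<le> t \<longrightarrow> w i y = w i x \<longrightarrow> y = x)"
      using x(1,2) unfolding z by (intro exI[of _ z]) auto
  qed (use \<open>a > 0\<close> in \<open>simp add: w_def\<close>)
  have m: "m \<le> a * Suc k"
    using assms(1) by simp
  show thesis
  proof (rule that[of colour])
    show "colour t < a + b" if "t < m" for t
      using that m assms(3) by (intro colour_less[of t a b]) auto
    show "card {t. t < m \<and> colour t = j} \<le> k" for j
    proof (rule card_colour_le[OF m])
      fix c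
      let ?A = "{(i, r). i < a \<and> r < k \<and> w i r = c}"
      \<comment> \<open>At a fixed offset the \<open>a\<close> shifts yield different colours, so a
        colour is used at most once for each of the \<open>k\<close> offsets.\<close>
      have "inj_on snd ?A"
      proof (rule inj_onI)
        fix p q
        assume pq: "p \<in> ?A" "q \<in> ?A" "snd p = snd q"
        obtain i r j where p: "p = (i, r)" and q: "q = (j, r)"
          using pq(3) by (cases p, cases q) simp
        have "[i + multiplicity 2 (Suc r) = j + multiplicity 2 (Suc r)] (mod a)"
          using pq(1,2) unfolding p q by (simp add: w_def cong_def)
        then have "[i = j] (mod a)"
          by (simp only: cong_add_rcancel_nat)
        then show "p = q"
          using pq(1,2) unfolding p q by (simp add: cong_def)
      qed
      then have "card ?A = card (snd ` ?A)"
        by (simp add: card_image)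
      also have "\<dots> \<le> card {..<k}"
        by (intro card_mono) auto
      finally show "card ?A \<le> k"
        by simp
    qed (use False in simp)
  qed (rule colour_unique)
qed

section \<open>Edges and normals of polygons\<close>

text \<open>Moving from \<open>z\<close> towards the strictly feasible point \<open>o1\<close> makes
  all constraints strict at once.\<close>

lemma closure_strict_system:
  fixes u :: "'i \<Rightarrow> 'a::euclidean_space"
  assumes "\<And>i. i \<in> I \<Longrightarrow> u i \<bullet> o1 < b i" "\<And>i. i \<in> I \<Longrightarrow> u i \<bullet> z \<le> b i"
  shows "z \<in> closure {y. \<forall>i\<in>I. u i \<bullet> y < b i}"
proof -
  have "u i \<bullet> y < b i" if "i \<in> I" "y \<in> open_segment z o1" for i y
  proof -
    obtain s where s: "0 < s" "s < 1" "y = (1 - s) *\<^sub>R z + s *\<^sub>R o1"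
      using \<open>y \<in> _\<close> by (auto simp: in_segment)
    have "u i \<bullet> y = (1 - s) * (u i \<bullet> z) + s * (u i \<bullet> o1)"
      by (simp add: s inner_add_right)
    also have "\<dots> < (1 - s) * b i + s * b i"
      using s assms[OF \<open>i \<in> I\<close>] by (intro add_le_less_mono mult_left_mono mult_strict_left_mono) auto
    finally show ?thesis
      by (simp add: algebra_simps)
  qed
  then have sub: "open_segment z o1 \<subseteq> {y. \<forall>i\<in>I. u i \<bullet> y < b i}"
    by blast
  show ?thesis
  proof (cases "z = o1")
    case True
    then have "z \<in> {y. \<forall>i\<in>I. u i \<bullet> y < b i}"
      using assms(1) by simp
    then show ?thesis
      by (rule closure_subset[THEN subsetD])
  next
    case False
    then have "z \<in> closure (open_segment z o1)"
      using closure_open_segment[of z o1] by auto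
    then show ?thesis
      using closure_mono[OF sub] by blast
  qed
qed

text \<open>The segment from \<open>o1\<close> to \<open>z\<close> leaves half-space
  \<open>i\<close> before it reaches \<open>z\<close>, so the constraints that are strict at
  \<open>o1\<close> and hold at \<open>z\<close> are still strict there.\<close>

lemma exists_point_on_one_facet:
  fixes u :: "'i \<Rightarrow> 'a::real_inner"
  assumes i: "u i \<bullet> o1 < b i" "u i \<bullet> z > b i"
  obtains w where "u i \<bullet> w = b i" "\<And>j. u j \<bullet> o1 < b j \<Longrightarrow> u j \<bullet> z \<le> b j \<Longrightarrow> u j \<bullet> w < b j"
proof
  define s where "s = (b i - u i \<bullet> o1) / (u i \<bullet> z - u i \<bullet> o1)"
  define w where "w = (1 - s) *\<^sub>R o1 + s *\<^sub>R z"
  have s: "0 < s" "s < 1"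
    using i by (auto simp: s_def field_simps)
  have w: "u j \<bullet> w = (1 - s) * (u j \<bullet> o1) + s * (u j \<bullet> z)" for j
    by (simp add: w_def inner_add_right)
  have "s * (u i \<bullet> z - u i \<bullet> o1) = b i - u i \<bullet> o1"
    using i by (simp add: s_def)
  then show "u i \<bullet> w = b i"
    unfolding w by (simp add: algebra_simps)
  fix j
  assume j: "u j \<bullet> o1 < b j" "u j \<bullet> z \<le> b j"
  have "u j \<bullet> w < (1 - s) * b j + s * b j"
    unfolding w using s j by (intro add_less_le_mono mult_left_mono mult_strict_left_mono) auto
  then show "u j \<bullet> w < b j"
    by (simp add: algebra_simps)
qed

lemma polygon_of_irredundant_system:
  fixes u :: "'i \<Rightarrow> real^2"
  assumes "finite I" and P: "P = {y. \<forall>i\<in>I. u i \<bullet> y \<le> b i}"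
    and o1: "\<And>i. i \<in> I \<Longrightarrow> u i \<bullet> o1 < b i"
    and irr: "\<And>i. i \<in> I \<Longrightarrow> \<exists>z. u i \<bullet> z > b i \<and> (\<forall>j\<in>I - {i}. u j \<bullet> z \<le> b j)"
  shows "polygon P" "interior P = {y. \<forall>i\<in>I. u i \<bullet> y < b i}" "card (edges P) = card I"
proof -
  let ?h = "\<lambda>i. {y. u i \<bullet> y \<le> b i}"
  define F where "F = ?h ` I"
  have inj: "inj_on ?h I"
  proof (rule inj_onI, rule ccontr)
    fix i j
    assume ij: "i \<in> I" "j \<in> I" "?h i = ?h j" "i \<noteq> j"
    obtain z where "u i \<bullet> z > b i" "\<forall>j\<in>I - {i}. u j \<bullet> z \<le> b j"
      using irr ij by blast
    then have "z \<in> ?h j" "z \<notin> ?h i"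
      using ij(2,4) by auto
    then show False
      using ij(3) by blast
  qed
  define v where "v = inv_into I ?h"
  have v: "v (?h i) = i" if "i \<in> I" for i
    unfolding v_def by (rule inv_into_f_f[OF inj that])
  have vF: "v h \<in> I" "?h (v h) = h" if "h \<in> F" for h
    using that v by (auto simp: F_def)
  have fin: "finite F"
    using \<open>finite I\<close> by (simp add: F_def)
  have PF: "P = \<Inter>F"
    by (auto simp: P F_def)
  have open_strict: "open {y. \<forall>i\<in>I. u i \<bullet> y < b i}"
    using \<open>finite I\<close> by (simp add: Collect_ball_eq open_INT open_halfspace_lt)
  have strict: "{y. \<forall>i\<in>I. u i \<bullet> y < b i} \<subseteq> interior P"
    using open_strict by (intro interior_maximal) (auto simp: P less_imp_le)
  then have int: "interior P \<noteq> {}"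
    using o1 by auto
  then have aff: "affine hull P = UNIV"
    by (rule affine_hull_nonempty_interior)
  have u0: "u i \<noteq> 0" if "i \<in> I" for i
    using irr[OF that] o1[OF that] by auto
  have faceq: "u (v h) \<noteq> 0 \<and> h = {x. u (v h) \<bullet> x \<le> b (v h)}" if "h \<in> F" for h
    using vF[OF that] u0 by auto
  have seq: "P = affine hull P \<inter> \<Inter>F"
    using PF aff by simp
  have psub: "P \<subset> affine hull P \<inter> \<Inter>F'" if F': "F' \<subset> F" for F'
  proof -
    obtain i where i: "i \<in> I" "?h i \<notin> F'" "F' \<subseteq> F"
      using F' by (auto simp: F_def)
    obtain z where z: "u i \<bullet> z > b i" "\<forall>j\<in>I - {i}. u j \<bullet> z \<le> b j"
      using irr i by blast
    have "z \<in> \<Inter>F'"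
    proof
      fix h assume "h \<in> F'"
      then have h: "h \<in> F" "h \<noteq> ?h i"
        using i by auto
      then have "v h \<in> I - {i}"
        using vF[of h] by auto
      then show "z \<in> h"
        using z vF(2)[OF h(1)] by auto
    qed
    moreover have "z \<notin> P"
      using z i by (auto simp: P not_le)
    ultimately show ?thesis
      using PF aff F' by auto
  qed
  have "polyhedron P"
    unfolding PF using fin by (intro polyhedron_Inter) (auto simp: F_def polyhedron_halfspace_le)
  then show "polygon P"
    using int by (simp add: polygon_def)
  have "interior P = {x \<in> P. \<forall>h\<in>F. u (v h) \<bullet> x < b (v h)}"
    using rel_interior_polyhedron_explicit[OF fin seq faceq psub]
      rel_interior_nonempty_interior[OF int] by simp
  then show "interior P = {y. \<forall>i\<in>I. u i \<bullet> y < b i}"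
    using strict interior_subset v by (fastforce simp: F_def)
  have facet: "C facet_of P \<longleftrightarrow> (\<exists>h. h \<in> F \<and> C = P \<inter> {x. u (v h) \<bullet> x = b (v h)})" for C
    by (rule facet_of_polyhedron_explicit[OF fin seq faceq psub])
  \<comment> \<open>\<open>P\<close> has dimension 2, so its facets have dimension 1.\<close>
  have "e edge_of P \<longleftrightarrow> e facet_of P" for e
    using aff_dim_nonempty_interior[OF int] by (auto simp: edge_of_def facet_of_def)
  then have "edges P = {C. \<exists>h. h \<in> F \<and> C = P \<inter> {x. u (v h) \<bullet> x = b (v h)}}"
    unfolding edges_def facet by simp
  also have "\<dots> = (\<lambda>i. P \<inter> {x. u i \<bullet> x = b i}) ` I"
    using v by (auto simp: F_def)
  finally have edges: "edges P = (\<lambda>i. P \<inter> {x. u i \<bullet> x = b i}) ` I" .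
  have "inj_on (\<lambda>i. P \<inter> {x. u i \<bullet> x = b i}) I"
  proof (rule inj_onI, rule ccontr)
    fix i j
    assume ij: "i \<in> I" "j \<in> I" and eq: "P \<inter> {x. u i \<bullet> x = b i} = P \<inter> {x. u j \<bullet> x = b j}"
      and "i \<noteq> j"
    obtain z where z: "u i \<bullet> z > b i" "\<forall>j\<in>I - {i}. u j \<bullet> z \<le> b j"
      using irr ij by blast
    \<comment> \<open>This point lies on edge \<open>i\<close> and on no other edge.\<close>
    obtain w where w: "u i \<bullet> w = b i"
      "\<And>j. u j \<bullet> o1 < b j \<Longrightarrow> u j \<bullet> z \<le> b j \<Longrightarrow> u j \<bullet> w < b j"
      using exists_point_on_one_facet[of u i o1 b z] o1[OF ij(1)] z(1) by blast
    have lt: "u l \<bullet> w < b l" if "l \<in> I - {i}" for l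
      using w(2)[of l] o1 z(2) that by auto
    have "w \<in> P"
      unfolding P using lt w(1) by (force intro: less_imp_le)
    then have "u j \<bullet> w = b j"
      using eq w(1) by auto
    then show False
      using lt[of j] ij \<open>i \<noteq> j\<close> by simp
  qed
  then show "card (edges P) = card I"
    unfolding edges by (rule card_image)
qed

text \<open>Relative to an interior point \<open>o1\<close> all right-hand sides are positive and
  scale to 1. A constraint is then a single vector, as in polar duality.\<close>

lemma polygon_irredundant_normals:
  assumes "polygon P"
  obtains U :: "(real^2) set" and o1 where "finite U" "card U = card (edges P)"
    "P = {y. \<forall>u\<in>U. u \<bullet> (y - o1) \<le> 1}" "interior P = {y. \<forall>u\<in>U. u \<bullet> (y - o1) < 1}"
    "\<forall>u\<in>U. \<exists>z. u \<bullet> z > 1 \<and> (\<forall>v\<in>U - {u}. v \<bullet> z \<le> 1)"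
proof -
  have int: "interior P \<noteq> {}" and "polyhedron P"
    using assms by (auto simp: polygon_def)
  have aff: "affine hull P = UNIV"
    using int by (rule affine_hull_nonempty_interior)
  obtain F where F: "finite F" "P = \<Inter>F" "\<forall>h\<in>F. \<exists>a b. a \<noteq> 0 \<and> h = {x. a \<bullet> x \<le> b}"
    "\<forall>F'. F' \<subset> F \<longrightarrow> P \<subset> \<Inter>F'"
    using \<open>polyhedron P\<close> unfolding polyhedron_Int_affine_minimal aff by auto
  then obtain a b where ab: "\<And>h. h \<in> F \<Longrightarrow> a h \<noteq> 0 \<and> h = {x. a h \<bullet> x \<le> b h}"
    by metis
  obtain o1 where o1: "o1 \<in> interior P"
    using int by blast
  have rel: "interior P = {x \<in> P. \<forall>h\<in>F. a h \<bullet> x < b h}"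
  proof -
    have "rel_interior P = {x \<in> P. \<forall>h\<in>F. a h \<bullet> x < b h}"
      by (rule rel_interior_polyhedron_explicit) (use F ab aff in auto)
    then show ?thesis
      using rel_interior_nonempty_interior[OF int] by simp
  qed
  have pos: "b h - a h \<bullet> o1 > 0" if "h \<in> F" for h
    using o1 that rel by auto
  define n where "n h = (1 / (b h - a h \<bullet> o1)) *\<^sub>R a h" for h
  have n: "y \<in> h \<longleftrightarrow> n h \<bullet> (y - o1) \<le> 1" if "h \<in> F" for h y
  proof -
    have "n h \<bullet> (y - o1) = (a h \<bullet> y - a h \<bullet> o1) / (b h - a h \<bullet> o1)"
      by (simp add: n_def inner_diff_right diff_divide_distrib)
    moreover have "y \<in> h \<longleftrightarrow> a h \<bullet> y \<le> b h"
      using ab[OF that] by blast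
    ultimately show ?thesis
      using pos[OF that] by (simp add: divide_le_eq_1_pos)
  qed
  have inj: "inj_on n F"
    by (rule inj_on_inverseI[where g = "\<lambda>v. {y. v \<bullet> (y - o1) \<le> 1}"]) (simp add: n[symmetric])
  have irr: "\<exists>z. n h \<bullet> z > 1 \<and> (\<forall>v\<in>n ` F - {n h}. v \<bullet> z \<le> 1)" if "h \<in> F" for h
  proof -
    have "P \<subset> \<Inter>(F - {h})"
      using F(4) that by blast
    then obtain z where z: "z \<notin> P" "z \<in> \<Inter>(F - {h})"
      by blast
    then have "z \<notin> h"
      using F(2) by auto
    have "n h \<bullet> (z - o1) > 1"
      using \<open>z \<notin> h\<close> n[OF that] by (auto simp: not_le)
    moreover have "v \<bullet> (z - o1) \<le> 1" if v: "v \<in> n ` F - {n h}" for v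
    proof -
      obtain g where g: "g \<in> F" "v = n g" "g \<noteq> h"
        using v by auto
      then have "z \<in> g"
        using z by auto
      then show ?thesis
        using n[OF g(1)] g(2) by auto
    qed
    ultimately show ?thesis
      by blast
  qed
  have PU: "P = {y. \<forall>u\<in>n ` F. u \<bullet> (y - o1) \<le> 1}"
    using F(2) n by auto
  have "P = {y. \<forall>u\<in>n ` F. u \<bullet> y \<le> 1 + u \<bullet> o1}"
    unfolding PU by (auto simp: inner_diff_right algebra_simps)
  note sys = polygon_of_irredundant_system[OF _ this, where ?o1.0 = o1]
  have irr': "\<exists>z. u \<bullet> z > 1 + u \<bullet> o1 \<and> (\<forall>v\<in>n ` F - {u}. v \<bullet> z \<le> 1 + v \<bullet> o1)" if u: "u \<in> n ` F" for u
  proof -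
    obtain z where "u \<bullet> z > 1" "\<forall>v\<in>n ` F - {u}. v \<bullet> z \<le> 1"
      using irr u by blast
    then show ?thesis
      by (intro exI[of _ "z + o1"]) (auto simp: inner_add_right)
  qed
  show thesis
  proof (rule that[of "n ` F" o1])
    show "finite (n ` F)"
      using F(1) by simp
    show "card (n ` F) = card (edges P)"
      using sys(3) irr' F(1) by simp
    show "P = {y. \<forall>u\<in>n ` F. u \<bullet> (y - o1) \<le> 1}"
      by (rule PU)
    have "interior P = {y. \<forall>u\<in>n ` F. u \<bullet> y < 1 + u \<bullet> o1}"
      using sys(2) irr' F(1) by simp
    then show "interior P = {y. \<forall>u\<in>n ` F. u \<bullet> (y - o1) < 1}"
      by (auto simp: inner_diff_right algebra_simps)
  qed (use irr in auto)
qed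

section \<open>Cyclic order of the normals\<close>

definition dir :: "real \<Rightarrow> real^2" where
  "dir \<theta> = vector [cos \<theta>, sin \<theta>]"

lemma inner_dir: "dir \<theta> \<bullet> x = cos \<theta> * x $ 1 + sin \<theta> * x $ 2"
  by (simp add: dir_def inner_vec_def UNIV_2)

lemma dir_add_2pi: "dir (\<theta> + 2 * pi) = dir \<theta>"
  by (simp add: dir_def)

lemma dir_add_pi: "dir (\<theta> + pi) = - dir \<theta>"
  by (simp add: dir_def vec_eq_iff forall_2)

lemma polar_form_vec2:
  fixes u :: "real^2"
  obtains \<theta> where "0 \<le> \<theta>" "\<theta> < 2 * pi" "u = norm u *\<^sub>R dir \<theta>"
proof
  define z where "z = Complex (u $ 1) (u $ 2)"
  have "norm u = cmod z"
    by (simp add: z_def cmod_def norm_vec_def L2_set_def UNIV_2)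
  then show "u = norm u *\<^sub>R dir (Arg2pi z)"
    using cos_Arg2pi[of z] sin_Arg2pi[of z] by (simp add: vec_eq_iff forall_2 dir_def z_def)
qed (use Arg2pi in auto)

text \<open>Polar duality: the three vectors are in convex position together with the origin, so the
  middle one is \<open>p\<close> times the first plus \<open>q\<close> times the last with \<open>p + q > 1\<close>.\<close>

lemma middle_constraint_violated:
  assumes "\<alpha> < \<beta>" "\<beta> < \<gamma>" "\<gamma> < \<alpha> + pi" and pos: "0 < r1" "0 < r2" "0 < r3"
    and z: "(r1 *\<^sub>R dir \<alpha>) \<bullet> z \<le> 1" "(r2 *\<^sub>R dir \<beta>) \<bullet> z > 1" "(r3 *\<^sub>R dir \<gamma>) \<bullet> z \<le> 1"
    and x: "(r1 *\<^sub>R dir \<alpha>) \<bullet> x \<ge> 1" "(r3 *\<^sub>R dir \<gamma>) \<bullet> x \<ge> 1"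
  shows "(r2 *\<^sub>R dir \<beta>) \<bullet> x > 1"
proof -
  define A B C where "A = sin (\<gamma> - \<beta>)" and "B = sin (\<beta> - \<alpha>)" and "C = sin (\<gamma> - \<alpha>)"
  have ABC: "0 < A" "0 < B" "0 < C"
    using assms(1-3) by (auto simp: A_def B_def C_def intro!: sin_gt_zero)
  \<comment> \<open>The middle direction is a combination of the outer ones; the coefficients are
    positive because the angle differences are less than \<open>pi\<close>.\<close>
  have key: "C * (dir \<beta> \<bullet> y) = A * (dir \<alpha> \<bullet> y) + B * (dir \<gamma> \<bullet> y)" for y
  proof -
    have "C * cos \<beta> = A * cos \<alpha> + B * cos \<gamma>" "C * sin \<beta> = A * sin \<alpha> + B * sin \<gamma>"
      unfolding A_def B_def C_def sin_diff by algebra+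
    then show ?thesis
      unfolding inner_dir by algebra
  qed
  \<comment> \<open>The point \<open>z\<close> compares the constants: it yields
    \<open>C / r2 < A / r1 + B / r3\<close>.\<close>
  have "C * (1 / r2) < C * (dir \<beta> \<bullet> z)"
    using ABC pos z(2) by (intro mult_strict_left_mono) (auto simp: field_simps)
  also have "\<dots> \<le> A * (1 / r1) + B * (1 / r3)"
    unfolding key using ABC pos z by (intro add_mono mult_left_mono) (auto simp: field_simps)
  also have "\<dots> \<le> C * (dir \<beta> \<bullet> x)"
    unfolding key using ABC pos x by (intro add_mono mult_left_mono) (auto simp: field_simps)
  finally have "1 / r2 < dir \<beta> \<bullet> x"
    using ABC(3) by (simp only: mult_less_cancel_left_pos)
  then show ?thesis
    using pos by (simp add: field_simps)
qed

text \<open>With the normals sorted by angle, a normal between two others less than a half-turn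
  apart is their positive combination, so violation at the outer ones passes to it. On the longer
  way round this would hit constraint 0. The outer constraints may be tight, as for points on edge
  lines.\<close>

lemma polygon_cyclic_normals:
  assumes "polygon P"
  obtains u :: "nat \<Rightarrow> real^2" and o1 where
    "P = {y. \<forall>i<card (edges P). u i \<bullet> (y - o1) \<le> 1}"
    "interior P = {y. \<forall>i<card (edges P). u i \<bullet> (y - o1) < 1}"
    "\<forall>i j k y. 0 < i \<and> i < j \<and> j < k \<and> k < card (edges P) \<and> u 0 \<bullet> (y - o1) \<le> 1 \<and>
      u i \<bullet> (y - o1) \<ge> 1 \<and> u k \<bullet> (y - o1) \<ge> 1 \<longrightarrow> u j \<bullet> (y - o1) > 1"
proof -
  define m where "m = card (edges P)"
  obtain U :: "(real^2) set" and o1 where U: "finite U" "card U = m"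
    "P = {y. \<forall>u\<in>U. u \<bullet> (y - o1) \<le> 1}" "interior P = {y. \<forall>u\<in>U. u \<bullet> (y - o1) < 1}"
    and irr': "\<forall>u\<in>U. \<exists>z. u \<bullet> z > 1 \<and> (\<forall>v\<in>U - {u}. v \<bullet> z \<le> 1)"
    by (rule polygon_irredundant_normals[OF assms, folded m_def])
  note irr = bspec[OF irr']
  have "\<exists>\<theta>. 0 \<le> \<theta> \<and> \<theta> < 2 * pi \<and> u = norm u *\<^sub>R dir \<theta>" for u :: "real^2"
    using polar_form_vec2[of u] by blast
  then obtain \<theta> :: "real^2 \<Rightarrow> real" where
    \<theta>: "\<And>u. 0 \<le> \<theta> u" "\<And>u. \<theta> u < 2 * pi" "\<And>u. u = norm u *\<^sub>R dir (\<theta> u)"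
    by metis
  have norm_pos: "norm u > 0" if "u \<in> U" for u
    using irr[OF that] by auto
  have "inj_on \<theta> U"
  proof (rule inj_onI, rule ccontr)
    fix u v
    assume uv: "u \<in> U" "v \<in> U" "\<theta> u = \<theta> v" "u \<noteq> v"
    \<comment> \<open>Of two normals in one direction the longer gives the stronger constraint,
      which makes the shorter one redundant, against \<open>irr\<close>.\<close>
    have "\<not> norm u < norm v" if uv: "u \<in> U" "v \<in> U" "\<theta> u = \<theta> v" "u \<noteq> v" for u v
    proof
      assume less: "norm u < norm v"
      obtain z where z: "u \<bullet> z > 1" "v \<bullet> z \<le> 1"
        using irr[OF uv(1)] uv(2,4) by auto
      define s where "s = dir (\<theta> u) \<bullet> z"
      have "u \<bullet> z = norm u * s" "v \<bullet> z = norm v * s"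
        using \<theta>(3)[of u] \<theta>(3)[of v] uv(3) by (metis inner_scaleR_left s_def)+
      moreover have "0 < s"
        using z(1) calculation(1) norm_pos[OF uv(1)]
        by (smt (verit) zero_less_mult_pos)
      then have "norm u * s \<le> norm v * s"
        using less by (intro mult_right_mono) auto
      ultimately show False
        using z by simp
    qed
    from this[of u v] this[of v u] uv have "norm u = norm v"
      by fastforce
    then show False
      using \<theta>(3)[of u] \<theta>(3)[of v] uv by simp
  qed
  define ts where "ts = sorted_list_of_set (\<theta> ` U)"
  have ts: "sorted_wrt (<) ts" "set ts = \<theta> ` U" "length ts = m"
    using U(1,2) \<open>inj_on \<theta> U\<close> by (auto simp: ts_def card_image)
  define u where "u i = inv_into U \<theta> (ts ! i)" for i
  have uU: "u i \<in> U" "\<theta> (u i) = ts ! i" if "i < m" for i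
  proof -
    have "ts ! i \<in> \<theta> ` U"
      using ts that nth_mem by metis
    then show "u i \<in> U" "\<theta> (u i) = ts ! i"
      unfolding u_def by (auto intro: inv_into_into f_inv_into_f)
  qed
  have image: "U = u ` {..<m}"
  proof
    show "U \<subseteq> u ` {..<m}"
    proof
      fix v assume "v \<in> U"
      then have "\<theta> v \<in> set ts"
        using ts by simp
      then obtain i where i: "i < m" "ts ! i = \<theta> v"
        using ts by (metis in_set_conv_nth)
      then have "u i = v"
        using uU[OF i(1)] \<open>inj_on \<theta> U\<close> \<open>v \<in> U\<close> by (metis inj_onD)
      then show "v \<in> u ` {..<m}"
        using i by auto
    qed
  qed (use uU in auto)
  have less: "\<theta> (u i) < \<theta> (u j)" if "i < j" "j < m" for i j
    using sorted_wrt_nth_less[OF ts(1) that(1)] that ts(3) uU(2) by simp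
  have polar: "u i = norm (u i) *\<^sub>R dir (\<theta> (u i))" for i
    by (rule \<theta>(3))
  \<comment> \<open>The angles are free up to full turns, so that arcs across the angle 0 are
    covered.\<close>
  have middle: "u j \<bullet> x > 1"
    if "i < m" "j < m" "k < m" "u i \<noteq> u j" "u k \<noteq> u j"
      and dir: "dir \<alpha> = dir (\<theta> (u i))" "dir \<beta> = dir (\<theta> (u j))" "dir \<gamma> = dir (\<theta> (u k))"
      and ang: "\<alpha> < \<beta>" "\<beta> < \<gamma>" "\<gamma> < \<alpha> + pi" and x: "u i \<bullet> x \<ge> 1" "u k \<bullet> x \<ge> 1"
    for i j k \<alpha> \<beta> \<gamma> x
  proof -
    have polar': "u i = norm (u i) *\<^sub>R dir \<alpha>" "u j = norm (u j) *\<^sub>R dir \<beta>" "u k = norm (u k) *\<^sub>R dir \<gamma>"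
      using polar dir by metis+
    have "u j \<in> U"
      using uU that(2) by blast
    then obtain z where "u j \<bullet> z > 1" "\<forall>v\<in>U - {u j}. v \<bullet> z \<le> 1"
      using irr by blast
    then have "u i \<bullet> z \<le> 1" "u j \<bullet> z > 1" "u k \<bullet> z \<le> 1"
      using uU that by auto
    then show ?thesis
      using middle_constraint_violated[OF ang, of "norm (u i)" "norm (u j)" "norm (u k)" z x]
        norm_pos[OF uU(1)] that(1-3) x unfolding polar'[symmetric] by simp
  qed
  have less_imp_neq: "u i \<noteq> u j" if "i < j" "j < m" for i j
    using less[OF that] by auto
  have order: "u j \<bullet> x > 1"
    if ijk: "0 < i" "i < j" "j < k" "k < m" and x0: "u 0 \<bullet> x \<le> 1" and x: "u i \<bullet> x \<ge> 1" "u k \<bullet> x \<ge> 1"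
    for i j k x
  proof -
    \<comment> \<open>The arc from normal \<open>i\<close> to normal \<open>k\<close> is shorter
      than, equal to or longer than a half-turn. Opposite normals cannot both reach 1 at
      \<open>x\<close>.\<close>
    consider "\<theta> (u k) < \<theta> (u i) + pi" | "\<theta> (u k) = \<theta> (u i) + pi" | "\<theta> (u i) + 2 * pi < \<theta> (u k) + pi"
      by linarith
    then show ?thesis
    proof cases
      case 1
      then show ?thesis
        using ijk x less less_imp_neq[of i j] less_imp_neq[of j k]
        by (intro middle[of i j k "\<theta> (u i)" "\<theta> (u j)" "\<theta> (u k)"]) auto
    next
      case 2
      define d where "d = dir (\<theta> (u i)) \<bullet> x"
      have "u i \<bullet> x = norm (u i) * d"
        by (subst polar) (simp add: d_def)
      moreover have "u k \<bullet> x = - (norm (u k) * d)"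
        by (subst polar) (simp add: d_def 2 dir_add_pi)
      ultimately have "norm (u i) * d > 0" "norm (u k) * d < 0"
        using x by linarith+
      then show ?thesis
        by (metis mult_less_0_iff norm_not_less_zero not_less_iff_gr_or_eq zero_less_mult_iff)
    next
      case 3
      \<comment> \<open>The complementary arc from \<open>k\<close> to \<open>i\<close> is shorter
        than a half-turn and contains normal 0.\<close>
      have "u 0 \<bullet> x > 1"
        using ijk 3 x less[of 0 i] less_imp_neq[of 0 i] less_imp_neq[of 0 k] \<theta>(1)[of "u 0"] \<theta>(2)[of "u k"]
        by (intro middle[of k 0 i "\<theta> (u k)" "\<theta> (u 0) + 2 * pi" "\<theta> (u i) + 2 * pi"])
          (auto simp: dir_add_2pi)
      then show ?thesis
        using x0 by simp
    qed
  qed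
  show thesis
  proof (rule that[of u o1])
    show "P = {y. \<forall>i<card (edges P). u i \<bullet> (y - o1) \<le> 1}"
      "interior P = {y. \<forall>i<card (edges P). u i \<bullet> (y - o1) < 1}"
      using U(3,4) unfolding image m_def by auto
  qed (use order m_def in blast)
qed

text \<open>
  The last polynomial cuts off all points violating the constraint \<open>0\<close>. For the other points
  outside of \<open>P\<close>, the violated constraints have consecutive indices, and the unique colour among
  them gives a product with exactly one negative factor, whose other factors are positive.
\<close>

lemma polygon_representable:
  assumes "polygon P" and m: "card (edges P) = Suc m" and k: "1 \<le> k"
    and ab: "m \<le> a * k" "k < 2 ^ a" "a < 2 ^ b"
  shows "open_representable (Suc (a + b)) k P" "closed_representable (Suc (a + b)) k P"
proof -
  obtain u o1 where P: "P = {y. \<forall>i<Suc m. u i \<bullet> (y - o1) \<le> 1}"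
    and int: "interior P = {y. \<forall>i<Suc m. u i \<bullet> (y - o1) < 1}"
    and cyc: "\<forall>i j k y. 0 < i \<and> i < j \<and> j < k \<and> k < Suc m \<and> u 0 \<bullet> (y - o1) \<le> 1 \<and>
      u i \<bullet> (y - o1) \<ge> 1 \<and> u k \<bullet> (y - o1) \<ge> 1 \<longrightarrow> u j \<bullet> (y - o1) > 1"
    by (rule polygon_cyclic_normals[OF assms(1), unfolded m])
  obtain c :: "nat \<Rightarrow> nat" where c_less: "\<And>t. t < m \<Longrightarrow> c t < a + b"
    and c_card: "\<And>j. card {t. t < m \<and> c t = j} \<le> k"
    and c_unique: "\<And>s t. s < t \<Longrightarrow> \<exists>x. s \<le> x \<and> x < t \<and>
      (\<forall>y. s \<le> Suc y \<longrightarrow> y \<le> t \<longrightarrow> c y = c x \<longrightarrow> y = x)"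
    by (rule balanced_conflict_free_colouring[OF ab]) blast
  define l where "l i y = 1 - u i \<bullet> (y - o1)" for i y
  define q where "q i = affine_form (u i) (1 + u i \<bullet> o1)" for i
  have q: "eval2 (q i) y = l i y" "total_degree (q i) \<le> 1" for i y
    unfolding q_def by (simp add: l_def eval2_affine_form inner_diff_right, rule total_degree_affine_form)
  define S where "S j = {t. t < m \<and> c t = j}" for j
  have finS [simp]: "finite (S j)" for j
    by (simp add: S_def)
  define p where "p j = (if j \<le> a + b then \<Prod>t\<in>S (j - 1). q (Suc t) else q 0)" for j
  have p_eval: "eval2 (p (Suc j)) y = (\<Prod>t\<in>S j. l (Suc t) y)" if "j < a + b" for j y
    using that by (simp add: p_def eval2_prod q)
  have p_last: "eval2 (p (Suc (a + b))) y = l 0 y" for y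
    by (simp add: p_def q)
  have deg: "total_degree (p j) \<le> k" for j
  proof -
    have "total_degree (\<Prod>t\<in>S (j - 1). q (Suc t)) \<le> (\<Sum>t\<in>S (j - 1). total_degree (q (Suc t)))"
      by (rule total_degree_prod_le)
    also have "\<dots> \<le> (\<Sum>t\<in>S (j - 1). 1)"
      by (intro sum_mono q)
    also have "\<dots> \<le> k"
      using c_card by (simp add: S_def)
    finally show ?thesis
      using k q(2)[of 0] by (simp add: p_def)
  qed
  have P_l: "y \<in> P \<longleftrightarrow> (\<forall>i<Suc m. l i y \<ge> 0)" and int_l: "y \<in> interior P \<longleftrightarrow> (\<forall>i<Suc m. l i y > 0)" for y
    unfolding int by (auto simp: P l_def)
  have idx: "j = Suc (a + b) \<or> (\<exists>i<a + b. j = Suc i)" if "j \<in> {1..Suc (a + b)}" for j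
    using that by (cases j) auto
  have nonneg: "eval2 (p j) y \<ge> 0" if "y \<in> P" "j \<in> {1..Suc (a + b)}" for j y
    using idx[OF that(2)] that(1) p_last p_eval
    by (auto simp: P_l S_def intro!: prod_nonneg)
  have pos: "eval2 (p j) y > 0" if "y \<in> interior P" "j \<in> {1..Suc (a + b)}" for j y
    using idx[OF that(2)] that(1) p_last p_eval
    by (auto simp: int_l S_def intro!: prod_pos)
  have neg: "\<exists>j\<in>{1..Suc (a + b)}. eval2 (p j) y < 0" if "y \<notin> P" for y
  proof (cases "l 0 y < 0")
    case True
    then show ?thesis
      using p_last by (intro bexI[of _ "Suc (a + b)"]) auto
  next
    case False
    define V where "V = {t. t < m \<and> l (Suc t) y < 0}"
    have cyc': "l (Suc t) y < 0"
      if "s < t" "t < r" "r < m" "l (Suc s) y \<le> 0" "l (Suc r) y \<le> 0" for s t r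
      using cyc[rule_format, of "Suc s" "Suc t" "Suc r" y] that False by (simp add: l_def)
    have "finite V"
      by (simp add: V_def)
    have "V \<noteq> {}"
      using that False unfolding P_l V_def
      by (auto simp: not_le) (metis less_Suc_eq_0_disj not_less)
    define s t where "s = Min V" and "t = Suc (Max V)"
    have st: "s \<in> V" "Max V \<in> V" "\<And>r. r \<in> V \<Longrightarrow> s \<le> r \<and> r < t"
      using \<open>finite V\<close> \<open>V \<noteq> {}\<close> by (auto simp: s_def t_def less_Suc_eq_le)
    then have "s < t"
      by blast
    then obtain x where x: "s \<le> x" "x < t"
      and uniq: "\<And>r. s \<le> Suc r \<Longrightarrow> r \<le> t \<Longrightarrow> c r = c x \<Longrightarrow> r = x"
      using c_unique by metis
    have xV: "x \<in> V"
      using cyc'[of s x "Max V"] st(1,2) x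
      by (cases "x = s"; cases "x = Max V") (auto simp: V_def t_def less_Suc_eq)
    \<comment> \<open>By \<open>uniq\<close>, a bad \<open>r\<close> would not touch
      \<open>[s, t)\<close>, and \<open>cyc'\<close> would then put a position outside
      \<open>[s, t)\<close> into \<open>V\<close>. At \<open>s - 1\<close> and \<open>t\<close> the
      constraint may vanish, hence the slack in the colouring.\<close>
    have "l (Suc r) y > 0" if "r \<in> S (c x) - {x}" for r
    proof (rule ccontr)
      assume "\<not> ?thesis"
      then have r: "l (Suc r) y \<le> 0" "r < m" "r \<noteq> x" "c r = c x"
        using that by (auto simp: S_def)
      then consider "Suc r < s" | "t < r"
        using uniq[of r] by linarith
      then show False
      proof cases
        case 1
        then have "Suc r \<in> V"
          using cyc'[of r "Suc r" s] r st(1) by (auto simp: V_def)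
        then show False
          using st(3) 1 by fastforce
      next
        case 2
        then have "t \<in> V"
          using cyc'[of "Max V" t r] r st(2) by (auto simp: V_def t_def)
        then show False
          using st(3) by blast
      qed
    qed
    then have "(\<Prod>r\<in>S (c x) - {x}. l (Suc r) y) > 0"
      by (intro prod_pos) auto
    moreover have "(\<Prod>r\<in>S (c x). l (Suc r) y) = l (Suc x) y * (\<Prod>r\<in>S (c x) - {x}. l (Suc r) y)"
      using xV by (intro prod.remove) (auto simp: S_def V_def)
    ultimately have "(\<Prod>r\<in>S (c x). l (Suc r) y) < 0"
      using xV by (auto simp: V_def mult_neg_pos)
    then show ?thesis
      using p_eval[of "c x" y] c_less[of x] xV
      by (intro bexI[of _ "Suc (c x)"]) (auto simp: V_def)
  qed
  \<comment> \<open>The strict system must also exclude boundary points; there a factor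
    vanishes.\<close>
  have zero: "\<exists>j\<in>{1..Suc (a + b)}. eval2 (p j) y = 0" if y: "y \<in> P" "y \<notin> interior P" for y
  proof -
    obtain i where "i < Suc m" "\<not> l i y > 0"
      using y(2) unfolding int_l by blast
    then have i: "i < Suc m" "l i y = 0"
      using y(1) unfolding P_l by (auto simp: not_less intro: antisym)
    show ?thesis
    proof (cases i)
      case 0
      then show ?thesis
        using i p_last by (intro bexI[of _ "Suc (a + b)"]) auto
    next
      case (Suc t)
      then have "(\<Prod>r\<in>S (c t). l (Suc r) y) = 0"
        using i by (intro prod_zero) (auto simp: S_def)
      then show ?thesis
        using p_eval[of "c t" y] c_less[of t] i Suc by (intro bexI[of _ "Suc (c t)"]) auto
    qed
  qed
  have "interior P = {x. \<forall>j\<in>{1..Suc (a + b)}. eval2 (p j) x > 0}"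
  proof (intro equalityI subsetI CollectI ballI)
    show "x \<in> interior P" if "x \<in> {x. \<forall>j\<in>{1..Suc (a + b)}. eval2 (p j) x > 0}" for x
      using that neg[of x] zero[of x] by (metis (mono_tags, lifting) mem_Collect_eq order.asym order.irrefl)
  qed (rule pos)
  then show "open_representable (Suc (a + b)) k P"
    unfolding open_representable_def by (intro exI[of _ p] conjI ballI deg)
  have "P = {x. \<forall>j\<in>{1..Suc (a + b)}. eval2 (p j) x \<ge> 0}"
  proof (intro equalityI subsetI CollectI ballI)
    show "x \<in> P" if "x \<in> {x. \<forall>j\<in>{1..Suc (a + b)}. eval2 (p j) x \<ge> 0}" for x
      using that neg[of x] by (metis (mono_tags, lifting) mem_Collect_eq not_less)
  qed (rule nonneg)
  then show "closed_representable (Suc (a + b)) k P"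
    unfolding closed_representable_def by (intro exI[of _ p] conjI ballI deg)
qed

section \<open>Lower bound\<close>

text \<open>The \<open>i\<close>-th line is the tangent of the parabola \<open>y = x^2\<close> at \<open>x = i\<close>.\<close>

definition parabola_polygon :: "nat \<Rightarrow> (real^2) set" where
  "parabola_polygon m = {y. \<forall>i\<in>{..<m}. vector [2 * real i, -1] \<bullet> y \<le> (real i)\<^sup>2}"

lemma inner_vector2: "vector [a, b] \<bullet> (y :: real^2) = a * y $ 1 + b * y $ 2"
  by (simp add: inner_vec_def UNIV_2)

text \<open>In this form the constraints at a point differ only in
  \<open>(x - real i)\<^sup>2\<close>, so comparing tangents means comparing distances from
  \<open>x\<close> to integers.\<close>

lemma tangent_le_iff:
  "vector [2 * real i, -1] \<bullet> (vector [x, y] :: real^2) \<le> (real i)\<^sup>2 \<longleftrightarrow> x\<^sup>2 - y \<le> (x - real i)\<^sup>2"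
  "vector [2 * real i, -1] \<bullet> (vector [x, y] :: real^2) < (real i)\<^sup>2 \<longleftrightarrow> x\<^sup>2 - y < (x - real i)\<^sup>2"
  by (auto simp: inner_vector2 power2_eq_square algebra_simps)

lemma one_le_sqr_diff: "i \<noteq> j \<Longrightarrow> 1 \<le> (real i - real j)\<^sup>2"
proof -
  assume "i \<noteq> j"
  then have "1 \<le> \<bar>real i - real j\<bar>"
    by linarith
  then show ?thesis
    using abs_le_square_iff[of 1 "real i - real j"] by simp
qed

lemma parabola_polygon:
  "polygon (parabola_polygon m)" (is ?A)
  "interior (parabola_polygon m) = {y. \<forall>i\<in>{..<m}. vector [2 * real i, -1] \<bullet> y < (real i)\<^sup>2}" (is ?B)
  "card (edges (parabola_polygon m)) = m" (is ?C)
proof -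
  let ?u = "\<lambda>i. vector [2 * real i, -1] :: real^2" and ?b = "\<lambda>i. (real i)\<^sup>2"
  have irr: "\<exists>z. ?u i \<bullet> z > ?b i \<and> (\<forall>j\<in>{..<m} - {i}. ?u j \<bullet> z \<le> ?b j)" for i
  proof (intro exI conjI ballI)
    \<comment> \<open>One unit below its point of tangency only tangent \<open>i\<close> is
      violated, since distinct integers differ by at least 1.\<close>
    show "?u i \<bullet> vector [real i, (real i)\<^sup>2 - 1] > ?b i"
      by (simp add: not_le[symmetric] tangent_le_iff)
    fix j assume "j \<in> {..<m} - {i}"
    then show "?u j \<bullet> vector [real i, (real i)\<^sup>2 - 1] \<le> ?b j"
      using one_le_sqr_diff[of i j] by (auto simp: tangent_le_iff)
  qed
  have sl: "?u i \<bullet> vector [0, 1] < ?b i" for i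
    by (simp add: tangent_le_iff) (smt (verit) zero_le_power2)
  note sys = polygon_of_irredundant_system[OF finite_lessThan parabola_polygon_def, where ?o1.0 = "vector [0, 1]"]
  show ?A ?B ?C
    using sys irr sl by simp_all
qed

definition tangent_point :: "nat \<Rightarrow> real \<Rightarrow> real^2" where
  "tangent_point i x = vector [x, 2 * real i * x - (real i)\<^sup>2]"

text \<open>The polygon lies above its tangents, and at abscissa \<open>x\<close> the highest
  tangent belongs to the nearest integer, here \<open>i\<close>.\<close>

lemma tangent_point_on_boundary:
  assumes "i < m" "\<bar>x - real i\<bar> < 1 / 2"
  shows "tangent_point i x \<in> parabola_polygon m"
    "tangent_point i x \<in> closure (interior (parabola_polygon m))"
    "tangent_point i x \<notin> interior (parabola_polygon m)"
proof -
  have le: "vector [2 * real j, -1] \<bullet> tangent_point i x \<le> (real j)\<^sup>2" for j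
  proof (cases "i = j")
    case False
    then have "1 \<le> \<bar>real i - real j\<bar>"
      by linarith
    then have "\<bar>x - real i\<bar> \<le> \<bar>x - real j\<bar>"
      using assms(2) by linarith
    then have "(x - real i)\<^sup>2 \<le> (x - real j)\<^sup>2"
      by (simp add: abs_le_square_iff)
    then show ?thesis
      unfolding tangent_point_def tangent_le_iff by (simp add: power2_eq_square algebra_simps)
  next
    case True
    then show ?thesis
      unfolding tangent_point_def tangent_le_iff by (simp add: power2_eq_square algebra_simps)
  qed
  then show "tangent_point i x \<in> parabola_polygon m"
    by (simp add: parabola_polygon_def)
  have sl: "vector [2 * real j, -1] \<bullet> (vector [0, 1] :: real^2) < (real j)\<^sup>2" for j
    by (simp add: tangent_le_iff) (smt (verit) zero_le_power2)
  show "tangent_point i x \<in> closure (interior (parabola_polygon m))"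
    unfolding parabola_polygon(2) by (rule closure_strict_system[OF sl le])
  have "\<not> vector [2 * real i, -1] \<bullet> tangent_point i x < (real i)\<^sup>2"
    unfolding tangent_point_def tangent_le_iff by (simp add: power2_eq_square algebra_simps)
  then show "tangent_point i x \<notin> interior (parabola_polygon m)"
    unfolding parabola_polygon(2) using assms(1) by blast
qed

section \<open>Restrictions of polynomials to lines\<close>

definition slice :: "real poly poly \<Rightarrow> real \<Rightarrow> real poly" where
  "slice p x = map_poly (\<lambda>q. poly q x) p"

lemma poly_slice: "poly (slice p x) y = eval2 p (vector [x, y])"
  unfolding slice_def eval2_def by (induction p) (auto simp: map_poly_pCons)

lemma degree_slice_le: "degree (slice p x) \<le> total_degree p"
  using map_poly_degree_leq[of "\<lambda>q. poly q x" p] degree_le_total_degree[of p]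
  by (simp add: slice_def)

text \<open>A vanishing slice makes \<open>x\<close> a root of the leading coefficient in
  \<open>Y\<close>, a nonzero univariate polynomial.\<close>

lemma finite_zero_slices:
  assumes "p \<noteq> 0"
  shows "finite {x. slice p x = 0}"
proof (rule finite_subset)
  show "{x. slice p x = 0} \<subseteq> {x. poly (lead_coeff p) x = 0}"
    by (auto simp: slice_def poly_eq_iff coeff_map_poly)
  show "finite {x. poly (lead_coeff p) x = 0}"
    using assms by (intro poly_roots_finite) simp
qed

lemma eval2_tangent_point:
  obtains r where "\<And>x. poly r x = eval2 p (tangent_point i x)"
proof
  fix x
  show "poly (poly p [:- (real i)\<^sup>2, 2 * real i:]) x = eval2 p (tangent_point i x)"
    unfolding eval2_def tangent_point_def
    by (induction p) (auto simp: algebra_simps)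
qed

text \<open>The tangents meet a vertical line \<open>x = c\<close> with \<open>c < 0\<close> in distinct points.\<close>

lemma card_tangents_in_zero_set:
  assumes "p \<noteq> 0" and I: "\<And>i x. i \<in> I \<Longrightarrow> eval2 p (tangent_point i x) = 0"
  shows "card I \<le> total_degree p"
proof -
  \<comment> \<open>Only finitely many vertical lines lie in the zero set of \<open>p\<close>, so
    some line with \<open>c < 0\<close> does not.\<close>
  have "infinite ({..<0::real} - {x. slice p x = 0})"
    using finite_zero_slices[OF assms(1)] by (intro Diff_infinite_finite infinite_Iio) auto
  then have "{..<0::real} - {x. slice p x = 0} \<noteq> {}"
    by (rule infinite_imp_nonempty)
  then obtain c where c: "c < 0" "slice p c \<noteq> 0"
    by blast
  let ?f = "\<lambda>i. 2 * real i * c - (real i)\<^sup>2"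
  have "inj ?f"
  proof (rule injI, rule ccontr)
    fix i j :: nat
    assume eq: "?f i = ?f j" and "i \<noteq> j"
    then have "(real i - real j) * (2 * c - real i - real j) = 0"
      by (simp add: power2_eq_square algebra_simps)
    then show False
      using \<open>i \<noteq> j\<close> c(1) by simp
  qed
  then have "inj_on ?f I"
    by (rule inj_on_subset) simp
  then have "card I = card (?f ` I)"
    by (simp add: card_image)
  also have "\<dots> \<le> card {y. poly (slice p c) y = 0}"
  proof (rule card_mono)
    show "finite {y. poly (slice p c) y = 0}"
      using c(2) by (rule poly_roots_finite)
    show "?f ` I \<subseteq> {y. poly (slice p c) y = 0}"
      using I[of _ c] by (auto simp: poly_slice tangent_point_def mult_ac)
  qed
  also have "\<dots> \<le> degree (slice p c)"
    using c by (intro card_poly_roots_bound)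
  also have "\<dots> \<le> total_degree p"
    by (rule degree_slice_le)
  finally show ?thesis .
qed

text \<open>Infinitely many points of an edge share one of finitely many polynomials, which then
  vanishes on the whole line; each polynomial absorbs at most \<open>k\<close> lines.\<close>

lemma edges_le_product:
  assumes deg: "\<And>j. j \<in> {1..n} \<Longrightarrow> total_degree (p j) \<le> k"
    and zero: "\<And>i x. i < m \<Longrightarrow> \<bar>x - real i\<bar> < 1 / 2 \<Longrightarrow>
      \<exists>j\<in>{1..n}. p j \<noteq> 0 \<and> eval2 (p j) (tangent_point i x) = 0"
  shows "m \<le> n * k"
proof -
  define I where "I j = {i. i < m \<and> p j \<noteq> 0 \<and> (\<forall>x. eval2 (p j) (tangent_point i x) = 0)}" for j
  have "i \<in> (\<Union>j\<in>{1..n}. I j)" if "i < m" for i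
  proof -
    let ?X = "{x. \<bar>x - real i\<bar> < 1 / 2}"
    have X: "?X \<subseteq> (\<Union>j\<in>{j \<in> {1..n}. p j \<noteq> 0}. {x. eval2 (p j) (tangent_point i x) = 0})"
      using zero[OF that] by blast
    have "infinite {real i - 1 / 2<..<real i + 1 / 2}"
      by (rule infinite_Ioo) simp
    moreover have "?X = {real i - 1 / 2<..<real i + 1 / 2}"
      unfolding abs_diff_less_iff by auto
    ultimately have "infinite ?X"
      by simp
    then obtain j where j: "j \<in> {1..n}" "p j \<noteq> 0" "infinite {x. eval2 (p j) (tangent_point i x) = 0}"
      using finite_subset[OF X] by auto
    obtain r where r: "\<And>x. poly r x = eval2 (p j) (tangent_point i x)"
      using eval2_tangent_point by blast
    have "r = 0"
      using j(3) poly_roots_finite[of r] unfolding r by blast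
    then have "i \<in> I j"
      using r j(2) that by (auto simp: I_def)
    then show ?thesis
      using j(1) by blast
  qed
  then have "card {..<m} \<le> card (\<Union>j\<in>{1..n}. I j)"
    by (intro card_mono) (auto simp: I_def)
  also have "\<dots> \<le> (\<Sum>j\<in>{1..n}. card (I j))"
    by (intro card_UN_le) simp
  also have "\<dots> \<le> (\<Sum>j\<in>{1..n}. k)"
  proof (rule sum_mono)
    fix j assume "j \<in> {1..n}"
    then show "card (I j) \<le> k"
      using card_tangents_in_zero_set[of "p j" "I j"] deg[of j]
      by (cases "p j = 0") (auto simp: I_def)
  qed
  finally show ?thesis
    by simp
qed

text \<open>At a boundary point some polynomial is not positive; as a limit of values on the
  interior it is nonnegative, hence zero.\<close>

lemma open_representable_parabola_polygon:
  assumes "open_representable n k (parabola_polygon m)"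
  shows "m \<le> n * k"
proof -
  obtain p where deg: "\<And>j. j \<in> {1..n} \<Longrightarrow> total_degree (p j) \<le> k"
    and int: "interior (parabola_polygon m) = {x. \<forall>j\<in>{1..n}. eval2 (p j) x > 0}"
    using assms unfolding open_representable_def by blast
  show ?thesis
  proof (rule edges_le_product[OF deg])
    fix i x
    assume ix: "i < m" "\<bar>x - real i\<bar> < 1 / 2"
    note tp = tangent_point_on_boundary[OF ix]
    obtain j where j: "j \<in> {1..n}" "eval2 (p j) (tangent_point i x) \<le> 0"
      using tp(3) unfolding int by (auto simp: not_less)
    have "closed {y. 0 \<le> eval2 (p j) y}"
      by (intro closed_Collect_le continuous_on_const continuous_on_eval2)
    moreover have "interior (parabola_polygon m) \<subseteq> {y. 0 \<le> eval2 (p j) y}"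
      unfolding int using j(1) less_imp_le by blast
    ultimately have "eval2 (p j) (tangent_point i x) \<ge> 0"
      using tp(2) closure_minimal by blast
    moreover have "p j \<noteq> 0"
    proof
      assume "p j = 0"
      then have "interior (parabola_polygon m) = {}"
        unfolding int using j(1) by (auto simp: eval2_def intro!: bexI[of _ j])
      then show False
        using parabola_polygon(1) by (simp add: polygon_def)
    qed
    ultimately show "\<exists>j\<in>{1..n}. p j \<noteq> 0 \<and> eval2 (p j) (tangent_point i x) = 0"
      using j by (intro bexI[of _ j]) auto
  qed
qed

text \<open>If all nonzero polynomials were positive at a boundary point, a neighbourhood would lie
  in the polygon. \<open>?J\<close> leaves out zero polynomials, whose inequality holds
  everywhere.\<close>

lemma closed_representable_parabola_polygon:
  assumes "closed_representable n k (parabola_polygon m)"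
  shows "m \<le> n * k"
proof -
  obtain p where deg: "\<And>j. j \<in> {1..n} \<Longrightarrow> total_degree (p j) \<le> k"
    and P: "parabola_polygon m = {x. \<forall>j\<in>{1..n}. eval2 (p j) x \<ge> 0}"
    using assms unfolding closed_representable_def by blast
  show ?thesis
  proof (rule edges_le_product[OF deg])
    fix i x
    assume ix: "i < m" "\<bar>x - real i\<bar> < 1 / 2"
    note tp = tangent_point_on_boundary[OF ix]
    let ?J = "{j \<in> {1..n}. p j \<noteq> 0}"
    have "open (\<Inter>j\<in>?J. {y. 0 < eval2 (p j) y})"
      by (intro open_INT open_Collect_less continuous_on_const continuous_on_eval2 ballI) auto
    moreover have "(\<Inter>j\<in>?J. {y. 0 < eval2 (p j) y}) \<subseteq> parabola_polygon m"
      unfolding P by (force simp: eval2_def intro: less_imp_le)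
    ultimately have "(\<Inter>j\<in>?J. {y. 0 < eval2 (p j) y}) \<subseteq> interior (parabola_polygon m)"
      by (intro interior_maximal)
    then have "tangent_point i x \<notin> (\<Inter>j\<in>?J. {y. 0 < eval2 (p j) y})"
      using tp(3) by blast
    then obtain j where "j \<in> ?J" "eval2 (p j) (tangent_point i x) \<le> 0"
      by (auto simp: not_less)
    moreover have "eval2 (p j) (tangent_point i x) \<ge> 0"
      using tp(1) calculation(1) unfolding P by blast
    ultimately show "\<exists>j\<in>{1..n}. p j \<noteq> 0 \<and> eval2 (p j) (tangent_point i x) = 0"
      by (intro bexI[of _ j]) auto
  qed
qed

section \<open>Asymptotics\<close>

text \<open>The construction with \<open>Suc (a + b)\<close> polynomials also shows that the minimum
  is attained, so the lower bound applies to it through the parabola polygon.\<close>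

lemma N_bounds:
  assumes "m \<ge> 1" "k \<ge> 1" "m \<le> a * k" "k < 2 ^ a" "a < 2 ^ b"
  shows "m \<le> N_open m k * k" "N_open m k \<le> Suc (a + b)"
    "m \<le> N_closed m k * k" "N_closed m k \<le> Suc (a + b)"
proof -
  let ?O = "\<lambda>n. n \<ge> 1 \<and> (\<forall>P. polygon P \<and> card (edges P) = m \<longrightarrow> open_representable n k P)"
    and ?C = "\<lambda>n. n \<ge> 1 \<and> (\<forall>P. polygon P \<and> card (edges P) = m \<longrightarrow> closed_representable n k P)"
  obtain m' where m': "m = Suc m'"
    using assms(1) by (cases m) auto
  have O: "?O (Suc (a + b))" and C: "?C (Suc (a + b))"
    using polygon_representable[of _ m' k a b] assms m' by simp_all
  have "?O (N_open m k)"
    unfolding N_open_def using O by (rule LeastI)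
  then show "m \<le> N_open m k * k"
    using parabola_polygon[of m] open_representable_parabola_polygon by blast
  have "?C (N_closed m k)"
    unfolding N_closed_def using C by (rule LeastI)
  then show "m \<le> N_closed m k * k"
    using parabola_polygon[of m] closed_representable_parabola_polygon by blast
  show "N_open m k \<le> Suc (a + b)"
    unfolding N_open_def using O by (rule Least_le)
  show "N_closed m k \<le> Suc (a + b)"
    unfolding N_closed_def using C by (rule Least_le)
qed

text \<open>With \<open>\<rho> = m / k\<close>, at most
  \<open>\<rho> + 3 + 2 * sqrt \<rho> / ln 2\<close> polynomials are needed; this is the overhead
  relative to \<open>\<rho>\<close>, estimated by \<open>\<rho> \<ge> log 2 m\<close>.\<close>

definition excess :: "nat \<Rightarrow> real" where
  "excess m = 3 / log 2 (real m) + 2 / (ln 2 * sqrt (log 2 (real m)))"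

lemma excess_tendsto: "excess \<longlonglongrightarrow> 0"
  unfolding excess_def by real_asymp

lemma log2_le_sqrt:
  assumes "x \<ge> 0"
  shows "log 2 (1 + x) \<le> 2 * sqrt x / ln 2"
proof -
  have "ln (1 + x) \<le> ln ((1 + sqrt x)\<^sup>2)"
    using assms by (subst ln_le_cancel_iff) (auto simp: power2_eq_square algebra_simps add_pos_nonneg)
  also have "\<dots> = 2 * ln (1 + sqrt x)"
    by (simp add: ln_realpow add_pos_nonneg assms)
  also have "\<dots> \<le> 2 * sqrt x"
    using ln_add_one_self_le_self[of "sqrt x"] assms by simp
  finally show ?thesis
    by (simp add: log_def divide_right_mono)
qed

lemma N_asymptotic_bounds:
  assumes "m \<ge> 2" "k \<ge> 1" "real k \<le> real m / log 2 (real m)"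
  shows "real m / real k \<le> real (N_open m k)" "real (N_open m k) \<le> (1 + excess m) * (real m / real k)"
    "real m / real k \<le> real (N_closed m k)" "real (N_closed m k) \<le> (1 + excess m) * (real m / real k)"
proof -
  define \<rho> where "\<rho> = real m / real k"
  define lg where "lg = log 2 (real m)"
  have lg: "1 \<le> lg"
    using assms(1) by (simp add: lg_def le_log_iff)
  have \<rho>: "lg \<le> \<rho>"
    using assms lg by (simp add: \<rho>_def lg_def field_simps)
  \<comment> \<open>\<open>a\<close> is the least integer above \<open>\<rho>\<close>, and
    \<open>b\<close> is the number of binary digits of \<open>a\<close>.\<close>
  define a where "a = Suc (m div k)"
  define b where "b = nat \<lfloor>log 2 (real a)\<rfloor> + 1"
  have div_le: "real (m div k) \<le> \<rho>"
    unfolding \<rho>_def by (rule of_nat_div_le_of_nat)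
  have ak: "m < a * k"
    using dividend_less_div_times[of k m] assms(2) by (simp add: a_def)
  then have "\<rho> < a"
    using assms(2) by (simp add: \<rho>_def divide_less_eq flip: of_nat_mult)
  have "real m / lg \<le> real m / 1"
    using lg by (intro divide_left_mono) auto
  then have "k \<le> m"
    using assms(3) by (simp add: lg_def)
  \<comment> \<open>The range of \<open>k\<close> enters here:
    \<open>a > \<rho> \<ge> log 2 m\<close>.\<close>
  moreover have "real m < 2 powr a"
    using \<rho> \<open>\<rho> < a\<close> assms(1) by (simp add: less_powr_iff flip: lg_def)
  then have "m < 2 ^ a"
    by (simp add: powr_realpow)
  ultimately have "k < 2 ^ a"
    by (rule le_less_trans)
  have "log 2 a < b"
    unfolding b_def by linarith
  then have "real a < 2 powr b"
    by (simp add: less_powr_iff a_def)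
  then have "a < 2 ^ b"
    by (simp add: powr_realpow)
  note N = N_bounds[OF _ assms(2) less_imp_le[OF ak] \<open>k < 2 ^ a\<close> \<open>a < 2 ^ b\<close>]
  have a_le: "real a \<le> 1 + \<rho>"
    using div_le by (simp add: a_def)
  have "0 \<le> log 2 a"
    by (simp add: a_def)
  then have "real b \<le> log 2 a + 1"
    unfolding b_def by (simp add: floor_le_iff)
  also have "log 2 a \<le> log 2 (1 + \<rho>)"
    using a_le by (simp add: a_def)
  also have "\<dots> \<le> 2 * sqrt \<rho> / ln 2"
    using \<rho> lg by (intro log2_le_sqrt) simp
  \<comment> \<open>The 3 collects the rounding in \<open>a\<close>, the rounding in
    \<open>b\<close> and the constraint of edge 0.\<close>
  finally have "real (Suc (a + b)) \<le> \<rho> + 3 + 2 * sqrt \<rho> / ln 2"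
    using a_le by simp
  also have "\<dots> \<le> \<rho> + 3 * (\<rho> / lg) + 2 * (\<rho> / sqrt lg) / ln 2"
  proof -
    have "1 \<le> \<rho> / lg"
      using \<rho> lg by simp
    moreover have "sqrt \<rho> = \<rho> / sqrt \<rho>"
      using \<rho> lg by (simp add: real_div_sqrt)
    then have "sqrt \<rho> \<le> \<rho> / sqrt lg"
      using \<rho> lg divide_left_mono[of "sqrt lg" "sqrt \<rho>" \<rho>] by simp
    then have "2 * sqrt \<rho> / ln 2 \<le> 2 * (\<rho> / sqrt lg) / ln 2"
      by (intro divide_right_mono mult_left_mono) auto
    ultimately show ?thesis
      by linarith
  qed
  also have "\<dots> = (1 + excess m) * \<rho>"
    by (simp add: excess_def lg_def algebra_simps)
  finally have upper: "real (Suc (a + b)) \<le> (1 + excess m) * (real m / real k)"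
    unfolding \<rho>_def .
  have lower: "real m / real k \<le> real n" if "m \<le> n * k" for n
    using that assms(2) by (simp add: divide_le_eq flip: of_nat_mult)
  show "real m / real k \<le> real (N_open m k)" "real m / real k \<le> real (N_closed m k)"
    using N assms(1) by (auto intro: lower)
  show "real (N_open m k) \<le> (1 + excess m) * (real m / real k)"
    "real (N_closed m k) \<le> (1 + excess m) * (real m / real k)"
    using N assms(1) upper by linarith+
qed

theorem theorem1p1:
  "(\<exists>\<epsilon> :: nat \<Rightarrow> real. \<epsilon> \<longlonglongrightarrow> 0 \<and>
      (\<forall>m k :: nat. m \<ge> 2 \<and> k \<ge> 1 \<and> real k \<le> real m / log 2 (real m) \<longrightarrow>
         real m / real k \<le> real (N_open m k) \<and>
         real (N_open m k) \<le> (1 + \<epsilon> m) * (real m / real k)))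
   \<and>
   (\<exists>\<epsilon> :: nat \<Rightarrow> real. \<epsilon> \<longlonglongrightarrow> 0 \<and>
      (\<forall>m k :: nat. m \<ge> 2 \<and> k \<ge> 1 \<and> real k \<le> real m / log 2 (real m) \<longrightarrow>
         real m / real k \<le> real (N_closed m k) \<and>
         real (N_closed m k) \<le> (1 + \<epsilon> m) * (real m / real k)))"
proof (intro conjI exI[of _ excess] allI impI excess_tendsto)
  fix m k :: nat
  assume "m \<ge> 2 \<and> k \<ge> 1 \<and> real k \<le> real m / log 2 (real m)"
  then show "real m / real k \<le> real (N_open m k)"
    "real (N_open m k) \<le> (1 + excess m) * (real m / real k)"
    "real m / real k \<le> real (N_closed m k)"
    "real (N_closed m k) \<le> (1 + excess m) * (real m / real k)"
    using N_asymptotic_bounds[of m k] by blast+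
qed

end
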